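(* Let $\widehat{X}$ be a sandpile graph that is undirected and such that $X$ (the graph obtained by deleting the sink) is connected. If $X$ consists of a single loopless vertex, then $\mathcal{M}(\widehat{X})$ has exactly one idempotent (namely $0$). Otherwise, $\mathcal{M}(\widehat{X})$ has exactly two idempotents ($0$ and the identity of the sandpile group $\mathcal{G}(\widehat{X})$).
   Context: A sandpile graph $\widehat{X}$ is a finite weakly connected directed multigraph (loops and multiple edges allowed) with a distinguished vertex, the sink, reachable by a directed path from every vertex; the set of non-sink vertices is nonempty. An undirected graph is regarded as a directed one by replacing each edge with a pair of opposite directed edges. A configuration assigns a nonnegative integer number of grains to each non-sink vertex; it is stable if every $v$ holds fewer than $\deg^{+}(v)$ (out-degree) grains. Toppling an unstable vertex sends one grain along each of its out-edges (grains at the sink vanish; the sink never topples); every configuration has a unique stabilization. $\mathcal{M}(\widehat X)$ is the set of stable configurations with $a\oplus b$ = stabilization of $a+b$ (commutative monoid with identity the empty configuration $0$). $\mathcal G(\widehat X)$ is the minimal ideal of $\mathcal M(\widehat X)$, which is a group. *)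

theory Defs
  imports
    "Graph_Theory.Bidirected_Digraph"
    "Graph_Theory.Digraph_Component"
    "HOL-Algebra.Group"
begin

locale sandpile_graph = fin_digraph G for G :: "('a, 'b) pre_digraph" +
  fixes sink :: 'a
  assumes sink_in_verts: "sink \<in> verts G"
    and weakly_connected: "Digraph_Component.connected G"
    and reachable_sink: "v \<in> verts G \<Longrightarrow> v \<rightarrow>\<^sup>*\<^bsub>G\<^esub> sink"
    and nonsink_nonempty: "verts G - {sink} \<noteq> {}"

text \<open>The involution \<^term>\<open>arev\<close> of a bidirected digraph has no fixed point among the
  arcs, so the arcs split into pairs of opposite arcs, one pair for each undirected edge.
  In particular an undirected loop is a pair of loop arcs.\<close>

definition undirected :: "('a, 'b) pre_digraph \<Rightarrow> bool" where
  "undirected G \<longleftrightarrow> (\<exists>arev. bidirected_digraph G arev)"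

definition delete_sink :: "('a, 'b) pre_digraph \<Rightarrow> 'a \<Rightarrow> ('a, 'b) pre_digraph" where
  "delete_sink G sink = pre_digraph.del_vert G sink"

definition single_loopless_vertex :: "('a, 'b) pre_digraph \<Rightarrow> bool" where
  "single_loopless_vertex X \<longleftrightarrow>
    (\<exists>v. verts X = {v}) \<and> (\<forall>a \<in> arcs X. tail X a \<noteq> head X a)"

text \<open>Configurations are total functions; the value outside the non-sink vertices is
  fixed to 0 so that equality of functions is equality of configurations.\<close>

definition configurations :: "('a, 'b) pre_digraph \<Rightarrow> 'a \<Rightarrow> ('a \<Rightarrow> nat) set" where
  "configurations G sink = {c. \<forall>v. v \<notin> verts G - {sink} \<longrightarrow> c v = 0}"

definition stable :: "('a, 'b) pre_digraph \<Rightarrow> 'a \<Rightarrow> ('a \<Rightarrow> nat) \<Rightarrow> bool" where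
  "stable G sink c \<longleftrightarrow> (\<forall>v \<in> verts G - {sink}. c v < out_degree G v)"

definition topple :: "('a, 'b) pre_digraph \<Rightarrow> 'a \<Rightarrow> 'a \<Rightarrow> ('a \<Rightarrow> nat) \<Rightarrow> ('a \<Rightarrow> nat)" where
  "topple G sink v c = (\<lambda>w.
     if w \<in> verts G - {sink}
     then (if w = v then c w - out_degree G v else c w)
          + card {a \<in> arcs G. tail G a = v \<and> head G a = w}
     else 0)"

definition toppling_step ::
  "('a, 'b) pre_digraph \<Rightarrow> 'a \<Rightarrow> ('a \<Rightarrow> nat) \<Rightarrow> ('a \<Rightarrow> nat) \<Rightarrow> bool" where
  "toppling_step G sink c d \<longleftrightarrow>
    (\<exists>v \<in> verts G - {sink}. out_degree G v \<le> c v \<and> d = topple G sink v c)"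

definition stabilization :: "('a, 'b) pre_digraph \<Rightarrow> 'a \<Rightarrow> ('a \<Rightarrow> nat) \<Rightarrow> ('a \<Rightarrow> nat)" where
  "stabilization G sink c = (THE d. (toppling_step G sink)\<^sup>*\<^sup>* c d \<and> stable G sink d)"

definition sandpile_monoid :: "('a, 'b) pre_digraph \<Rightarrow> 'a \<Rightarrow> ('a \<Rightarrow> nat) monoid" where
  "sandpile_monoid G sink =
    \<lparr> carrier = {c \<in> configurations G sink. stable G sink c},
      monoid.mult = (\<lambda>a b. stabilization G sink (\<lambda>v. a v + b v)),
      one = (\<lambda>v. 0) \<rparr>"

definition idempotents :: "('c, 'd) monoid_scheme \<Rightarrow> 'c set" where
  "idempotents M = {e \<in> carrier M. e \<otimes>\<^bsub>M\<^esub> e = e}"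

definition monoid_ideal :: "('c, 'd) monoid_scheme \<Rightarrow> 'c set \<Rightarrow> bool" where
  "monoid_ideal M I \<longleftrightarrow> I \<noteq> {} \<and> I \<subseteq> carrier M \<and>
    (\<forall>x \<in> I. \<forall>m \<in> carrier M. m \<otimes>\<^bsub>M\<^esub> x \<in> I \<and> x \<otimes>\<^bsub>M\<^esub> m \<in> I)"

definition minimal_ideal :: "('c, 'd) monoid_scheme \<Rightarrow> 'c set" where
  "minimal_ideal M =
    (THE I. monoid_ideal M I \<and> (\<forall>J. monoid_ideal M J \<and> J \<subseteq> I \<longrightarrow> J = I))"

text \<open>The identity of the sandpile group is in general different from the identity of the
  sandpile monoid.\<close>

definition sandpile_group :: "('a, 'b) pre_digraph \<Rightarrow> 'a \<Rightarrow> ('a \<Rightarrow> nat) monoid" where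
  "sandpile_group G sink =
    (let M = sandpile_monoid G sink; I = minimal_ideal M in
      \<lparr> carrier = I,
        monoid.mult = monoid.mult M,
        one = (THE e. e \<in> I \<and> (\<forall>x \<in> I. e \<otimes>\<^bsub>M\<^esub> x = x \<and> x \<otimes>\<^bsub>M\<^esub> e = x)) \<rparr>)"

end

theory Submission
  imports Defs "HOL-Algebra.FiniteProduct"
begin

text \<open>In a finite commutative monoid the minimal ideal consists of the elements that are
  multiples of every element, and it contains exactly one idempotent. If \<open>e \<noteq> 0\<close> is an idempotent
  of the sandpile monoid, then \<open>e\<close> is the stabilization of \<open>n e\<close> for every \<open>n \<ge> 1\<close>. For large \<open>n\<close>
  the grains at one vertex of the support of \<open>e\<close> can be spread by legal topplings along the
  strongly connected graph \<open>X\<close> until every vertex holds more grains than any prescribed \<open>m\<close>; hence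
  \<open>e\<close> is a multiple of every \<open>m\<close> and lies in the minimal ideal. Conversely, if every vertex of \<open>X\<close> has
  an arc inside \<open>X\<close>, then the vertex toppled last leaves a grain in \<open>X\<close>, so \<open>0\<close> is reached only
  from \<open>0\<close> and is not in the minimal ideal.\<close>

section \<open>The minimal ideal of a finite commutative monoid\<close>

context comm_monoid
begin

definition common_multiples :: "'a set" where
  "common_multiples = {x \<in> carrier G. \<forall>m \<in> carrier G. \<exists>y \<in> carrier G. x = m \<otimes> y}"

lemma common_multiplesE:
  assumes "x \<in> common_multiples" "m \<in> carrier G"
  obtains y where "y \<in> carrier G" "x = m \<otimes> y"
  using assms by (auto simp: common_multiples_def)

lemma common_multiples_mult:
  assumes x: "x \<in> common_multiples" and z: "z \<in> carrier G"
  shows "x \<otimes> z \<in> common_multiples"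
proof -
  have xc: "x \<in> carrier G" using x by (simp add: common_multiples_def)
  have "\<exists>y \<in> carrier G. x \<otimes> z = m \<otimes> y" if m: "m \<in> carrier G" for m
  proof -
    obtain y where y: "y \<in> carrier G" "x = m \<otimes> y" using common_multiplesE[OF x m] .
    then have "x \<otimes> z = m \<otimes> (y \<otimes> z)" using m z by (simp add: m_assoc)
    with y z show ?thesis by blast
  qed
  with xc z show ?thesis by (simp add: common_multiples_def)
qed

text \<open>The product of all elements of the finite carrier is a multiple of each of them.\<close>

lemma common_multiples_nonempty:
  assumes "finite (carrier G)"
  shows "common_multiples \<noteq> {}"
proof -
  have "finprod G (\<lambda>x. x) (carrier G) \<in> common_multiples"
  proof -
    have "\<exists>y \<in> carrier G. finprod G (\<lambda>x. x) (carrier G) = m \<otimes> y" if m: "m \<in> carrier G" for m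
    proof -
      have "finprod G (\<lambda>x. x) (insert m (carrier G - {m}))
          = m \<otimes> finprod G (\<lambda>x. x) (carrier G - {m})"
        by (rule finprod_insert) (use assms m in auto)
      moreover have "insert m (carrier G - {m}) = carrier G" using m by auto
      moreover have "finprod G (\<lambda>x. x) (carrier G - {m}) \<in> carrier G"
        by (rule finprod_closed) auto
      ultimately show ?thesis by auto
    qed
    then show ?thesis by (simp add: common_multiples_def)
  qed
  then show ?thesis by blast
qed

text \<open>An ideal contains some \<open>j\<close> and hence all multiples of \<open>j\<close>, so
  the common multiples lie in every ideal. As they form an ideal, no other ideal is minimal.\<close>

lemma minimal_ideal_eq_common_multiples:
  assumes "finite (carrier G)"
  shows "minimal_ideal G = common_multiples"
proof -
  have sub: "common_multiples \<subseteq> carrier G" by (auto simp: common_multiples_def)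
  have ideal: "monoid_ideal G common_multiples"
    unfolding monoid_ideal_def
    using common_multiples_nonempty[OF assms] sub common_multiples_mult
    by (metis m_comm subsetD)
  have least: "common_multiples \<subseteq> J" if J: "monoid_ideal G J" for J
  proof
    fix x assume x: "x \<in> common_multiples"
    obtain j where j: "j \<in> J" "j \<in> carrier G" using J by (auto simp: monoid_ideal_def)
    obtain y where "y \<in> carrier G" "x = j \<otimes> y" using common_multiplesE[OF x j(2)] .
    with J j show "x \<in> J" by (auto simp: monoid_ideal_def)
  qed
  show ?thesis
    unfolding minimal_ideal_def
  proof (rule the_equality)
    show "monoid_ideal G common_multiples \<and>
        (\<forall>J. monoid_ideal G J \<and> J \<subseteq> common_multiples \<longrightarrow> J = common_multiples)"
      using ideal least by blast
  next
    fix I assume "monoid_ideal G I \<and> (\<forall>J. monoid_ideal G J \<and> J \<subseteq> I \<longrightarrow> J = I)"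
    then show "I = common_multiples" using ideal least by blast
  qed
qed

lemma idempotent_absorbs_common_multiple:
  assumes e: "e \<in> carrier G" "e \<otimes> e = e" and x: "x \<in> common_multiples"
  shows "e \<otimes> x = x"
proof -
  obtain y where "y \<in> carrier G" "x = e \<otimes> y" using common_multiplesE[OF x e(1)] .
  then show ?thesis using e by (simp add: m_assoc[symmetric])
qed

text \<open>A common multiple \<open>x\<close> is a multiple of its own square. If
  \<open>x = x \<otimes> x \<otimes> y\<close>, then \<open>x \<otimes> y\<close> is
  idempotent.\<close>

lemma ex_idempotent_common_multiple:
  assumes "common_multiples \<noteq> {}"
  shows "\<exists>e \<in> common_multiples. e \<otimes> e = e"
proof -
  obtain x where x: "x \<in> common_multiples" using assms by blast
  then have xc: "x \<in> carrier G" by (simp add: common_multiples_def)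
  obtain y where y: "y \<in> carrier G" "x = x \<otimes> x \<otimes> y"
    using common_multiplesE[OF x m_closed[OF xc xc]] .
  have "(x \<otimes> y) \<otimes> (x \<otimes> y) = (x \<otimes> x \<otimes> y) \<otimes> y"
    using xc y(1) by (simp add: m_ac)
  also have "\<dots> = x \<otimes> y" by (simp only: y(2)[symmetric])
  finally show ?thesis using common_multiples_mult[OF x y(1)] by (rule bexI)
qed

text \<open>This evaluates the definite description by which \<open>sandpile_group\<close> picks its
  identity.\<close>

lemma identity_of_common_multiples_eq:
  assumes e: "e \<in> common_multiples" "e \<otimes> e = e"
  shows "(THE e. e \<in> common_multiples \<and> (\<forall>x \<in> common_multiples. e \<otimes> x = x \<and> x \<otimes> e = x)) = e"
proof (rule the_equality)
  have sub: "common_multiples \<subseteq> carrier G" by (auto simp: common_multiples_def)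
  have left: "e \<otimes> x = x" if "x \<in> common_multiples" for x
    using idempotent_absorbs_common_multiple that e sub by blast
  then show "e \<in> common_multiples \<and> (\<forall>x \<in> common_multiples. e \<otimes> x = x \<and> x \<otimes> e = x)"
    using e(1) sub by (metis m_comm subsetD)
  fix f assume "f \<in> common_multiples \<and> (\<forall>x \<in> common_multiples. f \<otimes> x = x \<and> x \<otimes> f = x)"
  \<comment> \<open>Both act as identities, so \<open>f = e \<otimes> f = e\<close>.\<close>
  then show "f = e" using left e(1) by metis
qed

end

section \<open>Stabilization\<close>

context sandpile_graph
begin

abbreviation nonsink :: "'a set" where
  "nonsink \<equiv> verts G - {sink}"

abbreviation step :: "('a \<Rightarrow> nat) \<Rightarrow> ('a \<Rightarrow> nat) \<Rightarrow> bool" where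
  "step \<equiv> toppling_step G sink"

abbreviation steps :: "('a \<Rightarrow> nat) \<Rightarrow> ('a \<Rightarrow> nat) \<Rightarrow> bool" where
  "steps \<equiv> step\<^sup>*\<^sup>*"

abbreviation stab :: "('a \<Rightarrow> nat) \<Rightarrow> ('a \<Rightarrow> nat)" where
  "stab \<equiv> stabilization G sink"

abbreviation num_arcs :: "'a \<Rightarrow> 'a \<Rightarrow> nat" where
  "num_arcs v w \<equiv> card {a \<in> arcs G. tail G a = v \<and> head G a = w}"

text \<open>Weighting each grain by \<open>h\<close> gives a potential that every toppling decreases. The choice
  is \<open>h = D ^ N - D ^ (N - d)\<close> with \<open>d\<close> the distance to the sink: one out-arc shortens \<open>d\<close>, and its
  gain of a factor \<open>D\<close> outweighs all the other out-arcs.\<close>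

lemma ex_strictly_superharmonic:
  "\<exists>h :: 'a \<Rightarrow> nat. h sink = 0 \<and>
    (\<forall>v \<in> nonsink. (\<Sum>a \<in> out_arcs G v. h (head G a)) < out_degree G v * h v)"
proof -
  define d where "d v = (LEAST k. (v, sink) \<in> arcs_ends G ^^ k)" for v
  \<comment> \<open>The sum is a convenient common upper bound of all distances.\<close>
  define N where "N = (\<Sum>v \<in> verts G. d v)"
  \<comment> \<open>This exceeds every out-degree.\<close>
  define D where "D = Suc (card (arcs G))"
  define h where "h v = D ^ N - D ^ (N - d v)" for v
  have D: "D \<ge> 1" by (simp add: D_def)
  have dN: "d v \<le> N" if "v \<in> verts G" for v
    unfolding N_def by (rule member_le_sum) (use that in auto)
  have d_sink: "d sink = 0"
    unfolding d_def by (rule Least_eq_0) simp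
  have closer: "\<exists>a \<in> out_arcs G v. d (head G a) < d v"
    if v: "v \<in> nonsink" for v
  proof -
    have "(v, sink) \<in> (arcs_ends G)\<^sup>*"
      using reachable_sink v by (auto intro: reachable_rtranclI)
    then obtain k where "(v, sink) \<in> arcs_ends G ^^ k" using rtrancl_imp_relpow by blast
    then have dv: "(v, sink) \<in> arcs_ends G ^^ d v" unfolding d_def by (rule LeastI)
    obtain j where j: "d v = Suc j" using dv v by (cases "d v") auto
    then obtain w where w: "(v, w) \<in> arcs_ends G" "(w, sink) \<in> arcs_ends G ^^ j"
      using dv by (metis relpow_Suc_E2)
    have "d w \<le> j" unfolding d_def by (rule Least_le) (rule w(2))
    moreover obtain a where "a \<in> arcs G" "tail G a = v" "head G a = w"
      using w(1) by (auto simp: arcs_ends_def arc_to_ends_def)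
    ultimately show ?thesis using j by (intro bexI[of _ a]) auto
  qed
  have "(\<Sum>a \<in> out_arcs G v. h (head G a)) < out_degree G v * h v" if v: "v \<in> nonsink" for v
  proof -
    obtain a where a: "a \<in> out_arcs G v" "d (head G a) < d v" using closer[OF v] by blast
    \<comment> \<open>The head of \<open>a\<close> weighs at most \<open>D ^ N - D * f\<close> and
      every other head at most \<open>D ^ N\<close>. Together they stay \<open>D * f\<close> below
      \<open>out_degree G v * D ^ N\<close>, whereas \<open>out_degree G v * h v\<close> stays only
      \<open>out_degree G v * f\<close> below it.\<close>
    define f where "f = D ^ (N - d v)"
    have fle: "f \<le> D ^ N" unfolding f_def by (rule power_increasing) (use D in auto)
    have "D * f \<le> D ^ (N - d (head G a))"
    proof -
      have "Suc (N - d v) \<le> N - d (head G a)" using a(2) dN[of v] v by auto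
      then have "D ^ Suc (N - d v) \<le> D ^ (N - d (head G a))" using D by (rule power_increasing)
      then show ?thesis by (simp add: f_def)
    qed
    then have ha: "h (head G a) \<le> D ^ N - D * f" by (simp add: h_def)
    have Df: "D * f \<le> D ^ N"
      using \<open>D * f \<le> D ^ (N - d (head G a))\<close> power_increasing[of "N - d (head G a)" N D] D
      by simp
    have deg: "out_degree G v < D"
      unfolding out_degree_def D_def by (auto simp: less_Suc_eq_le intro!: card_mono)
    have fpos: "0 < f" using D by (simp add: f_def)
    have deg_card: "out_degree G v = Suc (card (out_arcs G v - {a}))"
      unfolding out_degree_def by (rule card.remove) (use a(1) in auto)
    have "(\<Sum>b \<in> out_arcs G v. h (head G b))
        = h (head G a) + (\<Sum>b \<in> out_arcs G v - {a}. h (head G b))"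
      by (rule sum.remove) (use a(1) in auto)
    also have "\<dots> \<le> (D ^ N - D * f) + card (out_arcs G v - {a}) * D ^ N"
      using ha by (intro add_mono order.trans[OF sum_bounded_above[where K = "D ^ N"]])
        (auto simp: h_def)
    also have "\<dots> + D * f = out_degree G v * D ^ N"
      using Df by (simp add: deg_card)
    finally have "(\<Sum>b \<in> out_arcs G v. h (head G b)) + D * f \<le> out_degree G v * D ^ N"
      by simp
    moreover have "out_degree G v * f < D * f" using deg fpos by simp
    moreover have "out_degree G v * h v = out_degree G v * D ^ N - out_degree G v * f"
      by (simp add: h_def f_def diff_mult_distrib2)
    ultimately show ?thesis by linarith
  qed
  moreover have "h sink = 0" by (simp add: h_def d_sink)
  ultimately show ?thesis by blast
qed

section \<open>Toppling and its termination\<close>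

lemma finite_nonsink: "finite nonsink"
  by simp

lemma stable_iff_no_step: "stable G sink c \<longleftrightarrow> (\<nexists>d. step c d)"
  unfolding stable_def toppling_step_def by (meson not_le)

lemma stepI: "v \<in> nonsink \<Longrightarrow> out_degree G v \<le> c v \<Longrightarrow> step c (topple G sink v c)"
  by (auto simp: toppling_step_def)

lemma topple_at:
  "w \<in> nonsink \<Longrightarrow> topple G sink v c w
    = (if w = v then c w - out_degree G v else c w) + num_arcs v w"
  by (simp add: topple_def)

lemma topple_in_configurations: "topple G sink v c \<in> configurations G sink"
  by (simp add: topple_def configurations_def)

text \<open>Toppling trades the weight \<open>out_degree G v * h v\<close> for the weights of the
  heads of the out-arcs. Since \<open>h sink = 0\<close>, grains lost in the sink may be counted
  too.\<close>

lemma topple_decreases_potential: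
  assumes h: "h sink = 0" "(\<Sum>a \<in> out_arcs G v. h (head G a)) < out_degree G v * h v"
    and v: "v \<in> nonsink" "out_degree G v \<le> c v"
  shows "(\<Sum>w \<in> nonsink. topple G sink v c w * h w) < (\<Sum>w \<in> nonsink. c w * (h w :: nat))"
proof -
  have "(\<Sum>w \<in> nonsink. num_arcs v w * h w) = (\<Sum>w \<in> verts G. num_arcs v w * h w)"
    using h(1) by (intro sum.mono_neutral_left) auto
  also have "\<dots> = (\<Sum>w \<in> verts G. \<Sum>a \<in> {a \<in> out_arcs G v. head G a = w}. h (head G a))"
    by (intro sum.cong) (auto simp: conj_assoc)
  also have "\<dots> = (\<Sum>a \<in> out_arcs G v. h (head G a))"
    by (rule sum.group) auto
  finally have arcs: "(\<Sum>w \<in> nonsink. num_arcs v w * h w) = (\<Sum>a \<in> out_arcs G v. h (head G a))" .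
  \<comment> \<open>The lost weight is added on the left, which avoids subtraction of natural
    numbers.\<close>
  have "(\<Sum>w \<in> nonsink. topple G sink v c w * h w) + out_degree G v * h v
      = (\<Sum>w \<in> nonsink. topple G sink v c w * h w + (if w = v then out_degree G v * h v else 0))"
    using v(1) by (simp add: sum.distrib)
  also have "\<dots> = (\<Sum>w \<in> nonsink. c w * h w + num_arcs v w * h w)"
  proof (rule sum.cong)
    fix w assume w: "w \<in> nonsink"
    show "topple G sink v c w * h w + (if w = v then out_degree G v * h v else 0)
        = c w * h w + num_arcs v w * h w"
    proof (cases "w = v")
      case True
      have "c v = (c v - out_degree G v) + out_degree G v" using v(2) by simp
      then have "c v * h v = (c v - out_degree G v) * h v + out_degree G v * h v"
        by (metis add_mult_distrib)
      then show ?thesis using True w by (simp add: topple_at add_mult_distrib)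
    qed (use w in \<open>simp add: topple_at add_mult_distrib\<close>)
  qed simp
  also have "\<dots> = (\<Sum>w \<in> nonsink. c w * h w) + (\<Sum>a \<in> out_arcs G v. h (head G a))"
    by (simp add: sum.distrib arcs)
  finally show ?thesis using h(2) by linarith
qed

lemma ex_stabilization: "\<exists>d. steps c d \<and> stable G sink d"
proof -
  obtain h :: "'a \<Rightarrow> nat" where h: "h sink = 0"
    "\<And>v. v \<in> nonsink \<Longrightarrow> (\<Sum>a \<in> out_arcs G v. h (head G a)) < out_degree G v * h v"
    using ex_strictly_superharmonic by blast
  show ?thesis
  proof (induction "\<Sum>w \<in> nonsink. c w * h w" arbitrary: c rule: less_induct)
    case less
    show ?case
    proof (cases "stable G sink c")
      case False
      then obtain v where v: "v \<in> nonsink" "out_degree G v \<le> c v"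
        by (auto simp: stable_def not_less)
      then have "step c (topple G sink v c)" by (rule stepI)
      moreover obtain d where "steps (topple G sink v c) d" "stable G sink d"
        using less topple_decreases_potential[where h = h and c = c, OF h(1) h(2)[OF v(1)] v] by blast
      ultimately show ?thesis by (meson converse_rtranclp_into_rtranclp)
    qed blast
  qed
qed

section \<open>Confluence of toppling and uniqueness of the stable result\<close>

lemma topple_commute:
  assumes "v \<noteq> w" "out_degree G v \<le> c v" "out_degree G w \<le> c w"
  shows "topple G sink v (topple G sink w c) = topple G sink w (topple G sink v c)"
  using assms by (auto simp: topple_def fun_eq_iff)

text \<open>Toppling one vertex takes no grains from another, so a second unstable vertex remains
  unstable, and the order of the two topplings is irrelevant.\<close>

lemma step_diamond:
  assumes "step c d" "step c d'" "d \<noteq> d'"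
  shows "\<exists>e. step d e \<and> step d' e"
proof -
  obtain v w where v: "v \<in> nonsink" "out_degree G v \<le> c v" "d = topple G sink v c"
    and w: "w \<in> nonsink" "out_degree G w \<le> c w" "d' = topple G sink w c"
    using assms by (auto simp: toppling_step_def)
  have ne: "v \<noteq> w"
  proof
    assume "v = w"
    then have "d = d'" by (simp only: v(3) w(3))
    with assms(3) show False ..
  qed
  have "out_degree G w \<le> d w" unfolding v(3) using w(1,2) ne by (simp add: topple_at)
  with w(1) have "step d (topple G sink w d)" by (rule stepI)
  moreover have "out_degree G v \<le> d' v" unfolding w(3) using v(1,2) ne by (simp add: topple_at)
  with v(1) have "step d' (topple G sink v d')" by (rule stepI)
  moreover have "topple G sink w d = topple G sink v d'"
    unfolding v(3) w(3) using topple_commute[OF ne v(2) w(2)] by simp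
  ultimately show ?thesis by metis
qed

text \<open>The diamond is pushed along the sequence from \<open>c\<close> to \<open>d\<close>. The
  reflexive closure \<open>step\<^sup>=\<^sup>=\<close> covers the case that the single step is
  absorbed by the sequence.\<close>

lemma step_strip:
  assumes "steps c d" "step c d'"
  shows "\<exists>e. step\<^sup>=\<^sup>= d e \<and> steps d' e"
  using assms
proof (induction rule: rtranclp_induct)
  case base
  then show ?case by blast
next
  case (step y z)
  then obtain e where e: "step\<^sup>=\<^sup>= y e" "steps d' e" by blast
  show ?case
  proof (cases "y = e \<or> z = e")
    case True
    then show ?thesis using e step.hyps by (auto intro: rtranclp.rtrancl_into_rtrancl)
  next
    case False
    then have "step y e" using e by auto
    then obtain f where "step z f" "step e f" using step_diamond step.hyps(2) False by blast
    then show ?thesis using e(2) by (auto intro: rtranclp.rtrancl_into_rtrancl)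
  qed
qed

text \<open>The first step towards \<open>d'\<close> is stripped off against the sequence to
  \<open>d\<close>. As \<open>d\<close> is stable, the strip closes at \<open>d\<close> itself, so
  \<open>d\<close> is still reachable after that step.\<close>

lemma stabilization_unique:
  assumes "steps c d" "stable G sink d" "steps c d'" "stable G sink d'"
  shows "d = d'"
  using assms(3,1)
proof (induction rule: converse_rtranclp_induct)
  case base
  then show ?case using assms(4) stable_iff_no_step by (metis converse_rtranclpE)
next
  case (step y z)
  obtain e where "step\<^sup>=\<^sup>= d e" "steps z e" using step_strip[OF step.prems step.hyps(1)] by blast
  then have "steps z d" using assms(2) by (auto simp: stable_iff_no_step)
  then show ?case by (rule step.IH)
qed

lemma stab_eqI: "steps c d \<Longrightarrow> stable G sink d \<Longrightarrow> stab c = d"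
  unfolding stabilization_def using stabilization_unique by blast

lemma steps_stab: "steps c (stab c)" and stable_stab: "stable G sink (stab c)"
  using ex_stabilization[of c] stab_eqI by blast+

lemma stab_stable: "stable G sink c \<Longrightarrow> stab c = c"
  by (rule stab_eqI) auto

lemma stab_steps: "steps c d \<Longrightarrow> stab c = stab d"
  by (rule stab_eqI) (auto intro: rtranclp_trans steps_stab stable_stab)

section \<open>Stabilization and addition of configurations\<close>

lemma steps_configurations:
  assumes "steps c d" "c \<in> configurations G sink"
  shows "d \<in> configurations G sink"
  using assms
  by (induction rule: rtranclp_induct) (auto simp: toppling_step_def topple_in_configurations)

lemma stab_configurations: "c \<in> configurations G sink \<Longrightarrow> stab c \<in> configurations G sink"
  using steps_stab steps_configurations by blast

text \<open>Extra grains keep an unstable vertex unstable. The values of \<open>x\<close> off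
  \<open>nonsink\<close> must vanish because \<open>topple\<close> resets them to 0.\<close>

lemma step_add:
  assumes "step c d" "x \<in> configurations G sink"
  shows "step (\<lambda>v. c v + x v) (\<lambda>v. d v + x v)"
proof -
  obtain v where v: "v \<in> nonsink" "out_degree G v \<le> c v" "d = topple G sink v c"
    using assms(1) by (auto simp: toppling_step_def)
  have "topple G sink v (\<lambda>v. c v + x v) = (\<lambda>v. d v + x v)"
    using v assms(2) by (auto simp: topple_def fun_eq_iff configurations_def)
  then show ?thesis using v by (auto simp: toppling_step_def intro!: bexI[of _ v])
qed

lemma steps_add:
  assumes "steps c d" "x \<in> configurations G sink"
  shows "steps (\<lambda>v. c v + x v) (\<lambda>v. d v + x v)"
  using assms(1)
  by (induction rule: rtranclp_induct)
    (auto intro: rtranclp.rtrancl_into_rtrancl step_add[OF _ assms(2)])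

text \<open>Stabilizing one summand first is a legal start of stabilizing the sum; associativity of
  the monoid rests on this.\<close>

lemma stab_add_stab:
  assumes "x \<in> configurations G sink"
  shows "stab (\<lambda>v. stab c v + x v) = stab (\<lambda>v. c v + x v)"
  using stab_steps[OF steps_add[OF steps_stab assms]] by simp

section \<open>The sandpile monoid\<close>

abbreviation M :: "('a \<Rightarrow> nat) monoid" where
  "M \<equiv> sandpile_monoid G sink"

lemma carrier_M: "carrier M = {c \<in> configurations G sink. stable G sink c}"
  and mult_M: "a \<otimes>\<^bsub>M\<^esub> b = stab (\<lambda>v. a v + b v)"
  and one_M: "\<one>\<^bsub>M\<^esub> = (\<lambda>v. 0)"
  by (simp_all add: sandpile_monoid_def)

lemma add_configurations:
  "a \<in> configurations G sink \<Longrightarrow> b \<in> configurations G sink \<Longrightarrow>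
    (\<lambda>v. a v + b v) \<in> configurations G sink"
  by (simp add: configurations_def)

text \<open>A path to the sink has a first arc. This makes the empty configuration stable.\<close>

lemma out_degree_nonsink_pos:
  assumes "v \<in> nonsink"
  shows "0 < out_degree G v"
proof (rule ccontr)
  assume "\<not> 0 < out_degree G v"
  then have "out_arcs G v = {}" using finite_out_arcs[of v] by (simp add: out_degree_def)
  moreover have "v \<rightarrow>\<^sup>+\<^bsub>G\<^esub> sink" using reachable_sink assms by (auto intro: reachable_neq_reachable1)
  ultimately show False
    by (auto simp: arcs_ends_def arc_to_ends_def dest!: tranclD)
qed

lemma zero_in_carrier: "(\<lambda>v. 0) \<in> carrier M"
  by (simp add: carrier_M configurations_def stable_def out_degree_nonsink_pos)

lemma comm_monoid_M: "comm_monoid M"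
proof (rule comm_monoidI)
  fix x y assume xy: "x \<in> carrier M" "y \<in> carrier M"
  then show "x \<otimes>\<^bsub>M\<^esub> y \<in> carrier M"
    by (simp add: carrier_M mult_M stable_stab stab_configurations add_configurations)
  show "x \<otimes>\<^bsub>M\<^esub> y = y \<otimes>\<^bsub>M\<^esub> x" by (simp add: mult_M add.commute)
  fix z assume z: "z \<in> carrier M"
  have "stab (\<lambda>v. x v + stab (\<lambda>v. y v + z v) v) = stab (\<lambda>v. x v + (y v + z v))"
    using stab_add_stab[of x "\<lambda>v. y v + z v"] xy by (simp add: carrier_M add.commute)
  moreover have "stab (\<lambda>v. stab (\<lambda>v. x v + y v) v + z v) = stab (\<lambda>v. x v + y v + z v)"
    using stab_add_stab z by (simp add: carrier_M)
  ultimately show "x \<otimes>\<^bsub>M\<^esub> y \<otimes>\<^bsub>M\<^esub> z = x \<otimes>\<^bsub>M\<^esub> (y \<otimes>\<^bsub>M\<^esub> z)"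
    by (simp add: mult_M add.assoc)
qed (auto simp: one_M zero_in_carrier mult_M, simp add: stab_stable carrier_M)

lemma finite_carrier_M: "finite (carrier M)"
proof (rule finite_subset)
  \<comment> \<open>One bound for all vertices, as \<open>finite_set_of_finite_funs\<close> works
    with a common finite range.\<close>
  let ?B = "\<Sum>v \<in> nonsink. out_degree G v"
  show "carrier M \<subseteq> {c. \<forall>v. (v \<in> nonsink \<longrightarrow> c v \<in> {..?B}) \<and> (v \<notin> nonsink \<longrightarrow> c v = 0)}"
  proof
    fix c assume "c \<in> carrier M"
    then have c: "c \<in> configurations G sink" "stable G sink c" by (simp_all add: carrier_M)
    have "c v \<le> ?B" if v: "v \<in> nonsink" for v
    proof -
      have "c v < out_degree G v" using c(2) v unfolding stable_def by blast
      also have "\<dots> \<le> ?B" by (rule member_le_sum) (use v in auto)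
      finally show ?thesis by simp
    qed
    with c(1) show "c \<in> {c. \<forall>v. (v \<in> nonsink \<longrightarrow> c v \<in> {..?B}) \<and> (v \<notin> nonsink \<longrightarrow> c v = 0)}"
      by (simp add: configurations_def)
  qed
  show "finite {c. \<forall>v. (v \<in> nonsink \<longrightarrow> c v \<in> {..?B}) \<and> (v \<notin> nonsink \<longrightarrow> c v = (0 :: nat))}"
    by (rule finite_set_of_finite_funs) auto
qed

sublocale M: comm_monoid M
  by (rule comm_monoid_M)

section \<open>Idempotents\<close>

lemma stab_multiple_idempotent:
  assumes e: "e \<in> carrier M" "e \<otimes>\<^bsub>M\<^esub> e = e"
  shows "stab (\<lambda>v. Suc n * e v) = e"
proof (induction n)
  case 0
  then show ?case using e(1) by (simp add: carrier_M stab_stable)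
next
  case (Suc n)
  have "stab (\<lambda>v. Suc (Suc n) * e v) = stab (\<lambda>v. Suc n * e v + e v)"
    by (simp add: add_ac)
  also have "\<dots> = stab (\<lambda>v. stab (\<lambda>v. Suc n * e v) v + e v)"
    using stab_add_stab[of e] e(1) by (simp add: carrier_M)
  also have "\<dots> = e" using Suc e(2) by (simp add: mult_M)
  finally show ?case .
qed

section \<open>Spreading grains over the non-sink vertices\<close>

lemma steps_transfer:
  assumes a: "a \<in> arcs G" "tail G a = v" "head G a = w" and vw: "v \<in> nonsink" "w \<in> nonsink" "v \<noteq> w"
    and c: "k * out_degree G v \<le> c v"
  shows "\<exists>d. steps c d \<and> c w + k \<le> d w"
  using c
proof (induction k arbitrary: c)
  case 0
  then show ?case by auto
next
  case (Suc k)
  let ?c = "topple G sink v c"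
  \<comment> \<open>Each toppling of \<open>v\<close> costs \<open>out_degree G v\<close> grains
    there, and sends at least one grain along \<open>a\<close> to \<open>w\<close>, which itself is
    not toppled.\<close>
  have "step c ?c" using Suc.prems vw by (intro stepI) auto
  moreover have "k * out_degree G v \<le> ?c v" using Suc.prems vw by (simp add: topple_at)
  then obtain d where "steps ?c d" "?c w + k \<le> d w" using Suc.IH by blast
  moreover have "0 < num_arcs v w" using a by (auto simp: card_gt_0_iff)
  then have "c w + 1 \<le> ?c w" using vw by (simp add: topple_at)
  ultimately show ?case
    by (intro exI[of _ d]) (auto intro: converse_rtranclp_into_rtranclp)
qed

text \<open>The bound \<open>N\<close> is arbitrary so that the grains spent on later topplings can
  be demanded in advance.\<close>

definition fillable :: "('a \<Rightarrow> nat) \<Rightarrow> 'a set \<Rightarrow> bool" where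
  "fillable e S \<longleftrightarrow> (\<forall>N. \<exists>n c. steps (\<lambda>v. Suc n * e v) c \<and> (\<forall>v \<in> S. N \<le> c v))"

lemma fillableE:
  assumes "fillable e S"
  obtains n c where "steps (\<lambda>v. Suc n * e v) c" "\<forall>v \<in> S. N \<le> c v"
  using assms unfolding fillable_def by blast

lemma fillable_support: "e v \<noteq> 0 \<Longrightarrow> fillable e {v}"
  unfolding fillable_def
proof
  fix N assume "e v \<noteq> 0"
  then have "N \<le> Suc N * e v" by (cases "e v") auto
  then show "\<exists>n c. steps (\<lambda>v. Suc n * e v) c \<and> (\<forall>v \<in> {v}. N \<le> c v)"
    by (intro exI[of _ N] exI[of _ "\<lambda>v. Suc N * e v"]) auto
qed

lemma fillable_adjacent:
  assumes "fillable e {v}" "a \<in> arcs G" "tail G a = v" "head G a = w" "v \<in> nonsink" "w \<in> nonsink"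
  shows "fillable e {w}"
proof (cases "v = w")
  case False
  show ?thesis
    unfolding fillable_def
  proof
    fix N
    \<comment> \<open>Enough grains at \<open>v\<close> for \<open>N\<close> topplings.\<close>
    obtain n c where c: "steps (\<lambda>v. Suc n * e v) c" "N * out_degree G v \<le> c v"
      by (rule fillableE[OF assms(1), where N = "N * out_degree G v"]) blast
    then obtain d where "steps c d" "c w + N \<le> d w"
      using steps_transfer[OF assms(2-6) False] by blast
    with c(1) show "\<exists>n c. steps (\<lambda>v. Suc n * e v) c \<and> (\<forall>v \<in> {w}. N \<le> c v)"
      by (intro exI[of _ n] exI[of _ d]) auto
  qed
qed (use assms in simp)

text \<open>Separate batches of copies of \<open>e\<close> serve \<open>S\<close> and
  \<open>T\<close>. Each batch is toppled while the other one lies idle on top of it.\<close>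

lemma fillable_Un:
  assumes e: "e \<in> configurations G sink" and "fillable e S" "fillable e T"
  shows "fillable e (S \<union> T)"
  unfolding fillable_def
proof
  fix N
  obtain n c where c: "steps (\<lambda>v. Suc n * e v) c" "\<forall>v \<in> S. N \<le> c v"
    using fillableE[OF assms(2)] .
  obtain m d where d: "steps (\<lambda>v. Suc m * e v) d" "\<forall>v \<in> T. N \<le> d v"
    using fillableE[OF assms(3)] .
  have conf: "(\<lambda>v. k * e v) \<in> configurations G sink" for k
    using e by (simp add: configurations_def)
  have "steps (\<lambda>v. Suc n * e v + Suc m * e v) (\<lambda>v. c v + Suc m * e v)"
    using steps_add[OF c(1) conf] .
  moreover have "steps (\<lambda>v. Suc m * e v + c v) (\<lambda>v. d v + c v)"
    using steps_add[OF d(1) steps_configurations[OF c(1) conf]] .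
  ultimately have "steps (\<lambda>v. Suc n * e v + Suc m * e v) (\<lambda>v. c v + d v)"
    by (simp add: add.commute[of _ "c _"])
  moreover have "(\<lambda>v. Suc n * e v + Suc m * e v) = (\<lambda>v. Suc (n + m + 1) * e v)"
    by (simp add: fun_eq_iff algebra_simps)
  ultimately show "\<exists>n c. steps (\<lambda>v. Suc n * e v) c \<and> (\<forall>v \<in> S \<union> T. N \<le> c v)"
    using c(2) d(2) by (intro exI[of _ "n + m + 1"] exI[of _ "\<lambda>v. c v + d v"]) auto
qed

text \<open>A vertex in the support of \<open>e\<close> is fillable at once, paths that avoid the
  sink carry this to every other vertex, and \<open>fillable_Un\<close> joins the finitely many
  vertices.\<close>

lemma fillable_nonsink:
  assumes conn: "strongly_connected (delete_sink G sink)"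
    and e: "e \<in> configurations G sink" "e \<noteq> (\<lambda>v. 0)"
  shows "fillable e nonsink"
proof -
  interpret X: wf_digraph "delete_sink G sink"
    unfolding delete_sink_def by (rule wf_digraph_del_vert)
  obtain v where v: "e v \<noteq> 0" using e(2) by auto
  then have vns: "v \<in> nonsink" using e(1) by (auto simp: configurations_def)
  have single: "fillable e {w}" if w: "w \<in> nonsink" for w
  proof -
    have "v \<rightarrow>\<^sup>*\<^bsub>delete_sink G sink\<^esub> w"
      using conn vns w by (auto simp: strongly_connected_def delete_sink_def del_vert_simps)
    then show ?thesis
    proof (induction rule: X.reachable_induct)
      case base
      show ?case using fillable_support[where e = e, OF v] .
    next
      case (step x y)
      then obtain a where "a \<in> arcs (delete_sink G sink)" "tail G a = x" "head G a = y"
        by (auto simp: arcs_ends_def arc_to_ends_def delete_sink_def del_vert_simps)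
      then show ?case
        using fillable_adjacent[OF step.IH, of a y] by (auto simp: delete_sink_def del_vert_simps)
    qed
  qed
  have "fillable e (insert v S)" if "finite S" "S \<subseteq> nonsink" for S
    using that
  proof (induction S rule: finite_induct)
    case empty
    show ?case using fillable_support[where e = e, OF v] .
  next
    case (insert x S)
    then have "fillable e ({x} \<union> insert v S)" by (intro fillable_Un e(1) single) auto
    then show ?case by (simp add: insert_commute)
  qed
  from this[OF finite_nonsink subset_refl] show ?thesis using vns by (simp add: insert_absorb)
qed

lemma nonzero_idempotent_in_common_multiples:
  assumes conn: "strongly_connected (delete_sink G sink)"
    and e: "e \<in> carrier M" "e \<otimes>\<^bsub>M\<^esub> e = e" "e \<noteq> (\<lambda>v. 0)"
  shows "e \<in> M.common_multiples"
proof -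
  have econf: "e \<in> configurations G sink" using e(1) by (simp add: carrier_M)
  have "\<exists>y \<in> carrier M. e = m \<otimes>\<^bsub>M\<^esub> y" if m: "m \<in> carrier M" for m
  proof -
    have mconf: "m \<in> configurations G sink" using m by (simp add: carrier_M)
    \<comment> \<open>The total number of grains of \<open>m\<close> serves as the bound, since it
      dominates every \<open>m v\<close>.\<close>
    obtain n c where c: "steps (\<lambda>v. Suc n * e v) c"
      "\<forall>v \<in> nonsink. (\<Sum>v \<in> nonsink. m v) \<le> c v"
      using fillableE[OF fillable_nonsink[OF conn econf e(3)]] .
    have le: "m v \<le> c v" for v
    proof (cases "v \<in> nonsink")
      case True
      have "m v \<le> (\<Sum>v \<in> nonsink. m v)" by (rule member_le_sum) (use True in auto)
      then show ?thesis using c(2) True by (meson order.trans)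
    next
      case False
      then show ?thesis using mconf by (auto simp: configurations_def)
    qed
    have cconf: "c \<in> configurations G sink"
      by (rule steps_configurations[OF c(1)]) (use econf in \<open>simp add: configurations_def\<close>)
    \<comment> \<open>By \<open>le\<close> this subtraction is not truncated. The remainder
      \<open>x\<close> may be unstable, so \<open>stab x\<close> becomes the cofactor of
      \<open>m\<close>.\<close>
    define x where "x v = c v - m v" for v
    have xconf: "x \<in> configurations G sink"
      using cconf by (simp add: configurations_def x_def)
    have "e = stab c"
      using stab_multiple_idempotent[OF e(1,2)] stab_steps[OF c(1)] by metis
    also have "c = (\<lambda>v. x v + m v)" using le by (simp add: x_def)
    also have "stab \<dots> = stab (\<lambda>v. stab x v + m v)" using stab_add_stab[OF mconf] by simp
    also have "\<dots> = m \<otimes>\<^bsub>M\<^esub> stab x" by (simp add: mult_M add.commute)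
    finally show ?thesis
      using xconf by (intro bexI[of _ "stab x"])
        (simp_all add: carrier_M stable_stab stab_configurations)
  qed
  with e(1) show ?thesis by (simp add: M.common_multiples_def)
qed

section \<open>The empty configuration lies outside the minimal ideal\<close>

lemma steps_to_zero:
  assumes arcs: "\<forall>v \<in> nonsink. \<exists>a \<in> arcs G. tail G a = v \<and> head G a \<in> nonsink"
    and c: "steps c (\<lambda>v. 0)"
  shows "c = (\<lambda>v. 0)"
  using c
proof (cases rule: rtranclp.cases)
  case (rtrancl_into_rtrancl b)
  then obtain v where v: "v \<in> nonsink" "(\<lambda>v. 0) = topple G sink v b"
    by (auto simp: toppling_step_def)
  obtain a where a: "a \<in> arcs G" "tail G a = v" "head G a \<in> nonsink" using arcs v(1) by blast
  then have "0 < num_arcs v (head G a)" by (auto simp: card_gt_0_iff)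
  \<comment> \<open>The head may be \<open>v\<close> itself: \<open>topple\<close> adds the arriving
    grains after the subtraction.\<close>
  then have "0 < topple G sink v b (head G a)" using a(3) by (simp add: topple_at)
  then show ?thesis using v(2) by (metis less_irrefl)
qed simp

text \<open>It suffices to find a nonzero stable \<open>m\<close>, because
  \<open>steps_to_zero\<close> rules out \<open>m\<close> as a divisor of 0. A vertex with an arc to
  the sink also has an arc inside \<open>nonsink\<close>, so one grain on it is stable.\<close>

lemma zero_notin_common_multiples:
  assumes arcs: "\<forall>v \<in> nonsink. \<exists>a \<in> arcs G. tail G a = v \<and> head G a \<in> nonsink"
  shows "(\<lambda>v. 0) \<notin> M.common_multiples"
proof
  assume zero: "(\<lambda>v. 0) \<in> M.common_multiples"
  obtain u where "u \<in> nonsink" using nonsink_nonempty by blast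
  then have "u \<rightarrow>\<^sup>+\<^bsub>G\<^esub> sink" using reachable_sink by (auto intro: reachable_neq_reachable1)
  \<comment> \<open>The disjunct \<open>u = sink\<close> covers paths that meet the sink before
    their end.\<close>
  then have "u = sink \<or> (\<exists>v \<in> nonsink. v \<rightarrow>\<^bsub>G\<^esub> sink)"
    by (induction rule: converse_trancl_induct) (use adj_in_verts in blast)+
  then obtain v b where v: "v \<in> nonsink" and b: "b \<in> arcs G" "tail G b = v" "head G b = sink"
    using \<open>u \<in> nonsink\<close> by (auto simp: arcs_ends_def arc_to_ends_def)
  obtain a where a: "a \<in> arcs G" "tail G a = v" "head G a \<in> nonsink" using arcs v by blast
  have "card {a, b} \<le> out_degree G v"
    unfolding out_degree_def by (rule card_mono) (use a b in auto)
  moreover have "a \<noteq> b" using a b by auto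
  ultimately have deg: "1 < out_degree G v" by simp
  define m where "m w = (if w = v then 1 else 0 :: nat)" for w
  have "m \<in> carrier M"
    using v deg by (auto simp: carrier_M configurations_def stable_def m_def out_degree_nonsink_pos)
  then obtain y where "(\<lambda>v. 0) = m \<otimes>\<^bsub>M\<^esub> y" using M.common_multiplesE[OF zero] by metis
  then have "steps (\<lambda>w. m w + y w) (\<lambda>v. 0)" using steps_stab by (metis mult_M)
  then have "(\<lambda>w. m w + y w) = (\<lambda>v. 0)" by (rule steps_to_zero[OF arcs])
  then have "m v + y v = 0" by meson
  then show False by (simp add: m_def)
qed

text \<open>If \<open>v\<close> is the only non-sink vertex, it carries a loop; otherwise a path to
  another vertex of \<open>delete_sink G sink\<close> starts with such an arc.\<close>

lemma arc_inside_nonsink: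
  assumes conn: "strongly_connected (delete_sink G sink)"
    and X: "\<not> single_loopless_vertex (delete_sink G sink)" and v: "v \<in> nonsink"
  shows "\<exists>a \<in> arcs G. tail G a = v \<and> head G a \<in> nonsink"
proof (cases "nonsink = {v}")
  case True
  then obtain a where "a \<in> arcs G" "tail G a \<noteq> sink" "head G a \<noteq> sink" "tail G a = head G a"
    using X by (auto simp: single_loopless_vertex_def delete_sink_def del_vert_simps)
  moreover from this have "tail G a \<in> nonsink" "head G a \<in> nonsink" by auto
  ultimately show ?thesis using True by (intro bexI[of _ a]) auto
next
  case False
  interpret X: wf_digraph "delete_sink G sink"
    unfolding delete_sink_def by (rule wf_digraph_del_vert)
  obtain w where w: "w \<in> nonsink" "w \<noteq> v" using False v by blast
  then have "v \<rightarrow>\<^sup>*\<^bsub>delete_sink G sink\<^esub> w"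
    using conn v by (auto simp: strongly_connected_def delete_sink_def del_vert_simps)
  then have "v \<rightarrow>\<^sup>+\<^bsub>delete_sink G sink\<^esub> w" using w(2) by (auto intro: X.reachable_neq_reachable1)
  then obtain x where "(v, x) \<in> arcs_ends (delete_sink G sink)" by (meson tranclD)
  then show ?thesis
    by (auto simp: arcs_ends_def arc_to_ends_def delete_sink_def del_vert_simps)
qed

text \<open>All grains of a toppling go to the sink, so the monoid is addition modulo the out-degree
  of the only vertex, a group.\<close>

lemma idempotent_single_loopless:
  assumes X: "single_loopless_vertex (delete_sink G sink)"
    and e: "e \<in> carrier M" "e \<otimes>\<^bsub>M\<^esub> e = e"
  shows "e = (\<lambda>v. 0)"
proof -
  obtain v where v: "nonsink = {v}" and
    loopless: "\<And>a. a \<in> arcs G \<Longrightarrow> tail G a \<noteq> sink \<Longrightarrow> head G a \<noteq> sink \<Longrightarrow> tail G a \<noteq> head G a"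
    using X by (auto simp: single_loopless_vertex_def delete_sink_def del_vert_simps)
  have vns: "v \<in> nonsink" using v by simp
  have no_loop: "num_arcs v v = 0"
    using loopless vns by (metis (mono_tags, lifting) Collect_empty_eq DiffD2 card.empty singletonI)
  have ev: "e v < out_degree G v" and econf: "e \<in> configurations G sink"
    using e(1) vns by (auto simp: carrier_M stable_def)
  have "e v = 0"
  proof (cases "e v + e v < out_degree G v")
    case True
    then have "stable G sink (\<lambda>v. e v + e v)" unfolding stable_def v by simp
    then have "e = (\<lambda>v. e v + e v)" using e(2) by (simp add: mult_M stab_stable)
    then have "e v = e v + e v" by meson
    then show ?thesis by simp
  next
    case False
    \<comment> \<open>One toppling suffices, as \<open>e v + e v\<close> is less than twice the
      out-degree. Idempotence would then force \<open>e v\<close> to equal the out-degree.\<close>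
    let ?d = "topple G sink v (\<lambda>v. e v + e v)"
    have dv: "?d v = e v + e v - out_degree G v" using vns no_loop by (simp add: topple_at)
    have "step (\<lambda>v. e v + e v) ?d" by (rule stepI) (use False vns in auto)
    moreover have "stable G sink ?d" unfolding stable_def v using dv ev by simp
    ultimately have "stab (\<lambda>v. e v + e v) = ?d" by (metis stab_eqI r_into_rtranclp)
    then have "e v = e v + e v - out_degree G v" using e(2) dv by (simp add: mult_M)
    then show ?thesis using ev by simp
  qed
  moreover have "e w = 0" if "w \<noteq> v" for w
    using econf v that by (simp add: configurations_def)
  ultimately show ?thesis by metis
qed

lemma zero_idempotent: "(\<lambda>v. 0) \<in> idempotents M"
  using zero_in_carrier M.l_one[OF zero_in_carrier] by (simp add: idempotents_def one_M)

text \<open>A nonzero idempotent \<open>f\<close> is a common multiple, just like \<open>e\<close>.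
  Each absorbs the other, hence \<open>f = e\<close>.\<close>

lemma idempotents_eq:
  assumes conn: "strongly_connected (delete_sink G sink)"
    and X: "\<not> single_loopless_vertex (delete_sink G sink)"
  shows "idempotents M = {\<lambda>v. 0, \<one>\<^bsub>sandpile_group G sink\<^esub>} \<and>
    \<one>\<^bsub>sandpile_group G sink\<^esub> \<noteq> (\<lambda>v. 0)"
proof -
  obtain e where e: "e \<in> M.common_multiples" "e \<otimes>\<^bsub>M\<^esub> e = e"
    using M.ex_idempotent_common_multiple M.common_multiples_nonempty[OF finite_carrier_M] by blast
  have one: "\<one>\<^bsub>sandpile_group G sink\<^esub> = e"
    using M.identity_of_common_multiples_eq[OF e]
    by (simp add: sandpile_group_def Let_def M.minimal_ideal_eq_common_multiples finite_carrier_M)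
  have ec: "e \<in> carrier M" using e(1) by (simp add: M.common_multiples_def)
  have "f = e" if f: "f \<in> carrier M" "f \<otimes>\<^bsub>M\<^esub> f = f" "f \<noteq> (\<lambda>v. 0)" for f
  proof -
    have "f \<in> M.common_multiples" by (rule nonzero_idempotent_in_common_multiples[OF conn f])
    then show ?thesis
      using M.idempotent_absorbs_common_multiple e f ec M.m_comm by metis
  qed
  then have "idempotents M \<subseteq> {\<lambda>v. 0, e}"
    unfolding idempotents_def by blast
  moreover have "e \<in> idempotents M" using e(2) ec by (simp add: idempotents_def)
  ultimately have "idempotents M = {\<lambda>v. 0, e}" using zero_idempotent by blast
  moreover have "e \<noteq> (\<lambda>v. 0)"
    using zero_notin_common_multiples arc_inside_nonsink[OF conn X] e(1) by blast
  ultimately show ?thesis using one by simp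
qed

end

text \<open>An arc and its reverse have the same ends, so deleting \<open>u\<close> removes both or
  neither. Symmetry is what turns connectedness of \<open>delete_sink G sink\<close> into strong
  connectedness.\<close>

lemma (in bidirected_digraph) symmetric_del_vert: "symmetric (pre_digraph.del_vert G u)"
  unfolding symmetric_conv
proof
  fix a assume "a \<in> arcs (pre_digraph.del_vert G u)"
  then show "\<exists>b \<in> arcs (pre_digraph.del_vert G u).
      tail (pre_digraph.del_vert G u) a = head (pre_digraph.del_vert G u) b \<and>
      head (pre_digraph.del_vert G u) a = tail (pre_digraph.del_vert G u) b"
    by (intro bexI[of _ "arev a"]) (auto simp: del_vert_simps)
qed

theorem theorem4p1:
  fixes G :: "('a, 'b) pre_digraph" and sink :: 'a
  assumes "sandpile_graph G sink"
    and "undirected G"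
    and "Digraph_Component.connected (delete_sink G sink)"
  shows "(single_loopless_vertex (delete_sink G sink) \<longrightarrow>
            idempotents (sandpile_monoid G sink) = {\<lambda>v. 0}) \<and>
         (\<not> single_loopless_vertex (delete_sink G sink) \<longrightarrow>
            idempotents (sandpile_monoid G sink) = {\<lambda>v. 0, \<one>\<^bsub>sandpile_group G sink\<^esub>} \<and>
            \<one>\<^bsub>sandpile_group G sink\<^esub> \<noteq> (\<lambda>v. 0))"
proof -
  interpret sandpile_graph G sink by (rule assms(1))
  interpret X: wf_digraph "delete_sink G sink"
    unfolding delete_sink_def by (rule wf_digraph_del_vert)
  have "symmetric (delete_sink G sink)"
    using assms(2) bidirected_digraph.symmetric_del_vert[of G _ sink]
    by (auto simp: undirected_def delete_sink_def)
  then have conn: "strongly_connected (delete_sink G sink)"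
    using assms(3) by (rule X.symmetric_connected_imp_strongly_connected)
  have "idempotents M = {\<lambda>v. 0}" if "single_loopless_vertex (delete_sink G sink)"
    using zero_idempotent idempotent_single_loopless[OF that] unfolding idempotents_def by blast
  with idempotents_eq[OF conn] show ?thesis by blast
qed

end
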